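(* Let $G$, $X$ and the colouring rule $F$ be as described in the context, and let $X^*=\{x\in X: \text{for all } g\neq h \text{ in } G,\ gx\neq hx\}$. There exist pure colourings of $X^*\times\{a,b,c\}$ (i.e. colourings taking only the values $\delta_1,\delta_2,\delta_3$) that satisfy the colouring rule $F$.
   Context: Let $G$ be the semigroup (with identity $e$) generated by $T_1,T_2$ subject only to the relation $T_1^3T_2=T_2T_1^3$. Let $X=\{0,1\}^G$; $x^g$ is the $g$-coordinate; $G$ acts by $(g(x))^h=x^{gh}$. Let $m$ be the product probability measure giving a cylinder determined by $k$ coordinates measure $2^{-k}$ ($X^*$ has $m$-measure one). Let $X'=X\times\{a,b,c\}$ with $m'=m\times$ uniform. $C=\Delta(\{1,2,3\})$, whose vertices $\delta_i$ are the colours $c_i$ (indices mod 3 in $\{1,2,3\}$). Partition $G$ into six infinite enumerated sequences $(g^{(i,j)}_l)_{l\ge1}$, one per ordered pair $i\ne j$; put $r^x_{i,j}=\frac1{100}\sum_l2^{-l}x^{g^{(i,j)}_l}$ and let $A_x$ have diagonal $1$, off-diagonal entries $r^x_{i,j}$. $\{0,1\}$-arrays $B_1,B_0$ with entries $b_{i,j,k}$: in $B_1$, $b_{i,j,k}=1$ iff $i=j+1$ (mod 3); in $B_0$: for $k\ne1,j\ne3$, $b_{i,j,k}=1$ iff $i=j$; for $k\ne1,j=3$, iff $i=1$; for $k=1,j\ne3$, iff $i=j+1$; for $k=1,j=3$, iff $i=3$. Colouring rule $F$ for a colouring $c$ with values in $C$: $c(x,b)$ is a convex combination of the $\delta_i$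 maximising row $i$ of $A_{T_2T_1T_2(x)}c(T_1x,a)$; $c(x,c)$ is a convex combination of the $\delta_i$ maximising row $i$ of $A_{T_1T_2T_1(x)}c(T_2x,a)$; $c(x,a)$ is a convex combination of the $\delta_i$ maximising $\sum_{j,k}c(x,b)_jc(x,c)_kb_{i,j,k}$ with array $B_{x^e}$. A colouring satisfies $F$ if these conditions hold at ($m'$-almost) every point. *)

theory Defs
  imports "HOL-Analysis.Analysis"
begin

subsection \<open>The monoid \<open>G\<close>\<close>

datatype gen = Gen1 | Gen2

inductive word_cong :: "gen list \<Rightarrow> gen list \<Rightarrow> bool" where
  rel: "word_cong (u @ [Gen1, Gen1, Gen1, Gen2] @ v) (u @ [Gen2, Gen1, Gen1, Gen1] @ v)"
| refl: "word_cong u u"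
| sym: "word_cong u v \<Longrightarrow> word_cong v u"
| trans: "word_cong u v \<Longrightarrow> word_cong v w \<Longrightarrow> word_cong u w"

lemma word_cong_append_left: "word_cong u v \<Longrightarrow> word_cong (w @ u) (w @ v)"
proof (induction rule: word_cong.induct)
  case (rel u v)
  show ?case using word_cong.rel[of "w @ u" v] by simp
qed (rule word_cong.refl, erule word_cong.sym, erule (1) word_cong.trans)

lemma word_cong_append_right: "word_cong u v \<Longrightarrow> word_cong (u @ w) (v @ w)"
proof (induction rule: word_cong.induct)
  case (rel u v)
  show ?case using word_cong.rel[of u "v @ w"] by simp
qed (rule word_cong.refl, erule word_cong.sym, erule (1) word_cong.trans)

quotient_type G = "gen list" / word_cong
proof (rule equivpI)
  show "reflp word_cong" by (rule reflpI) (rule word_cong.refl)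
  show "symp word_cong" by (rule sympI) (erule word_cong.sym)
  show "transp word_cong" by (rule transpI) (erule (1) word_cong.trans)
qed

instantiation G :: monoid_mult
begin

lift_definition one_G :: G is "[]" .

lift_definition times_G :: "G \<Rightarrow> G \<Rightarrow> G" is "(@)"
  by (rule word_cong.trans[OF word_cong_append_left word_cong_append_right])

instance
  by standard (transfer, simp add: word_cong.refl)+

end

lift_definition T1 :: G is "[Gen1]" .
lift_definition T2 :: G is "[Gen2]" .

subsection \<open>The space \<open>X\<close> and the action\<close>

type_synonym X = "G \<Rightarrow> bool"

text \<open>Since \<open>act g (act h x) = act (h * g) x\<close>, composition of transformations reverses
  products in \<open>G\<close>; the words \<open>T2 * T1 * T2\<close> and \<open>T1 * T2 * T1\<close> used below are palindromes,
  so they denote the same transformation under either reading.\<close>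

definition act :: "G \<Rightarrow> X \<Rightarrow> X" where
  "act g x = (\<lambda>h. x (g * h))"

definition Xstar :: "X set" where
  "Xstar = {x. \<forall>g h. g \<noteq> h \<longrightarrow> act g x \<noteq> act h x}"

datatype label = Label_a | Label_b | Label_c

subsection \<open>Colours\<close>

text \<open>Colours are indexed by the type \<open>3\<close> of integers modulo 3, whose elements are \<open>1\<close>, \<open>2\<close>
  and \<open>3 = 0\<close>; thus \<open>j + 1\<close> is addition modulo 3.\<close>

definition \<delta> :: "3 \<Rightarrow> real ^ 3" where
  "\<delta> i = axis i 1"

definition C :: "(real ^ 3) set" where
  "C = {p. (\<forall>i. 0 \<le> p $ i) \<and> (\<Sum>i\<in>UNIV. p $ i) = 1}"

definition argmax_hull :: "(3 \<Rightarrow> real) \<Rightarrow> (real ^ 3) set" where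
  "argmax_hull f = convex hull (\<delta> ` {i. is_arg_max f (\<lambda>_. True) i})"

subsection \<open>The colouring rule\<close>

text \<open>\<open>s i j l\<close>, for \<open>i \<noteq> j\<close> and \<open>l \<ge> 1\<close>, is the \<open>l\<close>-th member of the sequence attached to
  the ordered pair \<open>(i, j)\<close>; other values are irrelevant.\<close>

definition enumerated_partition :: "(3 \<Rightarrow> 3 \<Rightarrow> nat \<Rightarrow> G) \<Rightarrow> bool" where
  "enumerated_partition s \<longleftrightarrow>
     bij_betw (\<lambda>(i, j, l). s i j l) {(i, j, l). i \<noteq> j \<and> 1 \<le> l} UNIV"

definition r :: "(3 \<Rightarrow> 3 \<Rightarrow> nat \<Rightarrow> G) \<Rightarrow> X \<Rightarrow> 3 \<Rightarrow> 3 \<Rightarrow> real" where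
  "r s x i j = 1 / 100 * (\<Sum>n. (1 / 2) ^ Suc n * of_bool (x (s i j (Suc n))))"

definition A :: "(3 \<Rightarrow> 3 \<Rightarrow> nat \<Rightarrow> G) \<Rightarrow> X \<Rightarrow> real ^ 3 ^ 3" where
  "A s x = (\<chi> i j. if i = j then 1 else r s x i j)"

definition B1 :: "3 \<Rightarrow> 3 \<Rightarrow> 3 \<Rightarrow> real" where
  "B1 i j k = of_bool (i = j + 1)"

definition B0 :: "3 \<Rightarrow> 3 \<Rightarrow> 3 \<Rightarrow> real" where
  "B0 i j k = of_bool (
     if k \<noteq> 1 then (if j \<noteq> 3 then i = j else i = 1)
     else (if j \<noteq> 3 then i = j + 1 else i = 3))"

definition colourings :: "X set \<Rightarrow> (X \<times> label \<Rightarrow> real ^ 3) set" where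
  "colourings S = S \<times> UNIV \<rightarrow>\<^sub>E C"

definition pure_colouring :: "X set \<Rightarrow> (X \<times> label \<Rightarrow> real ^ 3) \<Rightarrow> bool" where
  "pure_colouring S c \<longleftrightarrow> c ` (S \<times> UNIV) \<subseteq> {\<delta> 1, \<delta> 2, \<delta> 3}"

definition satisfies_F ::
  "(3 \<Rightarrow> 3 \<Rightarrow> nat \<Rightarrow> G) \<Rightarrow> X set \<Rightarrow> (X \<times> label \<Rightarrow> real ^ 3) \<Rightarrow> bool" where
  "satisfies_F s S c \<longleftrightarrow> (\<forall>x\<in>S.
     c (x, Label_b) \<in> argmax_hull (\<lambda>i. (A s (act (T2 * T1 * T2) x) *v c (act T1 x, Label_a)) $ i) \<and>
     c (x, Label_c) \<in> argmax_hull (\<lambda>i. (A s (act (T1 * T2 * T1) x) *v c (act T2 x, Label_a)) $ i) \<and>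
     c (x, Label_a) \<in> argmax_hull (\<lambda>i. \<Sum>j\<in>UNIV. \<Sum>k\<in>UNIV.
       c (x, Label_b) $ j * c (x, Label_c) $ k * (if x 1 then B1 else B0) i j k))"

subsection \<open>Invariance of \<open>Xstar\<close>\<close>

text \<open>A colouring of \<open>Xstar\<close> is unspecified outside \<open>Xstar\<close>, so the rule is meaningful there
  only because \<open>T1\<close> and \<open>T2\<close> map \<open>Xstar\<close> to itself. This follows from left cancellation in \<open>G\<close>,
  proved with the normal forms of the rewrite rule \<open>T2 T1 T1 T1 \<rightarrow> T1 T1 T1 T2\<close>.\<close>

fun push2 :: "gen list \<Rightarrow> gen list" where
  "push2 (Gen1 # Gen1 # Gen1 # u) = Gen1 # Gen1 # Gen1 # push2 u"
| "push2 u = Gen2 # u"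

fun normal_form :: "gen list \<Rightarrow> gen list" where
  "normal_form [] = []"
| "normal_form (Gen1 # u) = Gen1 # normal_form u"
| "normal_form (Gen2 # u) = push2 (normal_form u)"

lemma word_cong_Cons: "word_cong u v \<Longrightarrow> word_cong (a # u) (a # v)"
  using word_cong_append_left[of u v "[a]"] by simp

lemma word_cong_push2: "word_cong (push2 u) (Gen2 # u)"
proof (induction u rule: push2.induct)
  case (1 u)
  have "word_cong (Gen1 # Gen1 # Gen1 # push2 u) (Gen1 # Gen1 # Gen1 # Gen2 # u)"
    by (intro word_cong_Cons 1)
  moreover have "word_cong (Gen1 # Gen1 # Gen1 # Gen2 # u) (Gen2 # Gen1 # Gen1 # Gen1 # u)"
    using word_cong.rel[of "[]" u] by simp
  ultimately show ?case by (simp add: word_cong.trans)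
qed (simp_all add: word_cong.refl)

lemma word_cong_normal_form: "word_cong (normal_form u) u"
  by (induction u rule: normal_form.induct)
    (simp_all add: word_cong.refl word_cong_Cons word_cong.trans[OF word_cong_push2])

lemma normal_form_append_cong:
  "normal_form u = normal_form v \<Longrightarrow> normal_form (w @ u) = normal_form (w @ v)"
  by (induction w rule: normal_form.induct) auto

lemma normal_form_cong: "word_cong u v \<Longrightarrow> normal_form u = normal_form v"
proof (induction rule: word_cong.induct)
  case (rel u v)
  show ?case by (rule normal_form_append_cong) simp
qed auto

fun pop2 :: "gen list \<Rightarrow> gen list" where
  "pop2 (Gen1 # Gen1 # Gen1 # u) = Gen1 # Gen1 # Gen1 # pop2 u"
| "pop2 (Gen2 # u) = u"
| "pop2 u = u"

lemma pop2_push2: "pop2 (push2 u) = u"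
  by (induction u rule: push2.induct) simp_all

lemma push2_inject: "push2 u = push2 v \<Longrightarrow> u = v"
  by (metis pop2_push2)

lemma normal_form_Cons_inject:
  "normal_form (a # u) = normal_form (a # v) \<Longrightarrow> normal_form u = normal_form v"
  by (cases a) (auto dest: push2_inject)

lemma word_cong_Cons_cancel: "word_cong (a # u) (a # v) \<Longrightarrow> word_cong u v"
  using normal_form_Cons_inject[OF normal_form_cong, of a u v]
    word_cong.trans[OF word_cong.sym[OF word_cong_normal_form[of u]], of v]
    word_cong_normal_form[of v] by simp

lemma G_left_cancel: "T1 * g = T1 * h \<Longrightarrow> g = h" "T2 * g = T2 * h \<Longrightarrow> g = h"
  by (transfer, simp, erule word_cong_Cons_cancel)+

lemma Xstar_invariant:
  assumes "x \<in> Xstar"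
  shows "act T1 x \<in> Xstar" "act T2 x \<in> Xstar"
proof -
  have *: "act g (act t x) = act (t * g) x" for g t
    by (simp add: act_def mult.assoc)
  show "act T1 x \<in> Xstar" "act T2 x \<in> Xstar"
    using assms G_left_cancel unfolding Xstar_def * mem_Collect_eq by blast+
qed

end

theory Submission
  imports Defs
begin

text \<open>The off-diagonal entries of \<open>A\<^sub>x\<close> are smaller than the diagonal ones, so for pure
  colourings the rule makes \<open>b\<close> and \<open>c\<close> copy the colour of \<open>a\<close> at the images under \<open>T1\<close>
  and \<open>T2\<close>, and the colour of \<open>(x, a)\<close> becomes a function of the colours of \<open>(T1 x, a)\<close> and
  \<open>(T2 x, a)\<close>. On \<open>Xstar\<close> the graph \<open>x \<rightarrow> T1 x, T2 x\<close> has no directed cycles, hence finitely many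
  of these constraints can be solved by recursion; Tychonoff's theorem gives a solution
  of all of them.\<close>

text \<open>The converse of a finite acyclic relation is well-founded, so \<open>f\<close> can be
  built by recursion from the successors \<open>p x\<close> and \<open>q x\<close>.\<close>

lemma finite_acyclic_recursion_solvable:
  fixes \<Phi> :: "'a \<Rightarrow> 'c \<Rightarrow> 'c \<Rightarrow> 'c"
  assumes "finite F" and acyc: "acyclic {(x, y). x \<in> F \<and> (y = p x \<or> y = q x)}"
  shows "\<exists>f. \<forall>x\<in>F. f x = \<Phi> x (f (p x)) (f (q x))"
proof -
  let ?E = "{(x, y). x \<in> F \<and> (y = p x \<or> y = q x)}"
  define f where "f = wfrec (?E\<inverse>) (\<lambda>g x. \<Phi> x (g (p x)) (g (q x)))"
  have "?E = (\<lambda>x. (x, p x)) ` F \<union> (\<lambda>x. (x, q x)) ` F"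
    by auto
  then have "finite ?E"
    using \<open>finite F\<close> by simp
  then have "wf (?E\<inverse>)"
    using acyc by (rule finite_acyclic_wf_converse)
  then have "f x = \<Phi> x (f (p x)) (f (q x))" if "x \<in> F" for x
    \<comment> \<open>For \<open>x\<close> in \<open>F\<close> both \<open>p x\<close> and
      \<open>q x\<close> are successors of \<open>x\<close>, so the cut in the recursion equation
      leaves the values there intact.\<close>
    using that def_wfrec[OF eq_reflection[OF f_def], of x] by (simp add: cut_apply)
  then have "\<forall>x\<in>F. f x = \<Phi> x (f (p x)) (f (q x))" ..
  then show ?thesis
    by (rule exI[of _ f])
qed

text \<open>Infinite forward paths may rule out recursion on all of \<open>S\<close>. Instead each
  constraint is a closed set in a compact product of finite discrete spaces, and finitely many of
  them can be met together.\<close>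

lemma acyclic_recursion_solvable:
  fixes \<Phi> :: "'a \<Rightarrow> 'c::finite \<Rightarrow> 'c \<Rightarrow> 'c"
  assumes acyc: "acyclic {(x, y). x \<in> S \<and> (y = p x \<or> y = q x)}"
  shows "\<exists>f. \<forall>x\<in>S. f x = \<Phi> x (f (p x)) (f (q x))"
proof -
  let ?T = "product_topology (\<lambda>_::'a. discrete_topology (UNIV::'c set)) UNIV"
  define K where "K x = {f. f x = \<Phi> x (f (p x)) (f (q x))}" for x
  have "compact_space ?T"
    by (simp add: compact_space_product_topology compact_space_discrete_topology)
  moreover have "closedin ?T (K x)" for x
  proof -
    have fibre: "closedin ?T {f. f y = j}" for y j
    proof -
      have "continuous_map ?T (discrete_topology UNIV) (\<lambda>f. f y)"
        using continuous_map_product_projection[of y UNIV "\<lambda>_. discrete_topology UNIV"] by simp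
      from closedin_continuous_map_preimage[OF this, of "{j}"] show ?thesis
        by simp
    qed
    \<comment> \<open>Once the values \<open>j\<close> and \<open>k\<close> are fixed, the
      constraint only prescribes three coordinates; finiteness of \<open>'c\<close> makes the union
      finite.\<close>
    have "K x = (\<Union>(j, k)\<in>UNIV. {f. f (p x) = j} \<inter> ({f. f (q x) = k} \<inter> {f. f x = \<Phi> x j k}))"
      by (auto simp: K_def)
    also have "closedin ?T \<dots>"
      by (intro closedin_Union) (auto intro!: closedin_Int fibre)
    finally show ?thesis .
  qed
  moreover have "\<Inter>\<F> \<noteq> {}" if "finite \<F>" "\<F> \<subseteq> K ` S" for \<F>
  proof -
    from that obtain F where F: "F \<subseteq> S" "finite F" "\<F> = K ` F"
      by (meson finite_subset_image)
    have "acyclic {(x, y). x \<in> F \<and> (y = p x \<or> y = q x)}"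
      by (rule acyclic_subset[OF acyc]) (use F in auto)
    from finite_acyclic_recursion_solvable[OF \<open>finite F\<close> this, of \<Phi>]
    obtain f where "\<forall>x\<in>F. f x = \<Phi> x (f (p x)) (f (q x))" ..
    then have "f \<in> \<Inter>\<F>"
      using F by (simp add: K_def)
    then show ?thesis
      by blast
  qed
  ultimately have "\<Inter>(K ` S) \<noteq> {}"
    unfolding compact_space_fip by (auto dest!: spec[of _ "K ` S"])
  then obtain f where "f \<in> \<Inter>(K ` S)"
    by blast
  then have "\<forall>x\<in>S. f x = \<Phi> x (f (p x)) (f (q x))"
    by (simp add: K_def)
  then show ?thesis
    by (rule exI[of _ f])
qed

text \<open>The defining relation is homogeneous, so length is an invariant that separates nonempty
  words from the identity.\<close>

lemma word_cong_length: "word_cong u v \<Longrightarrow> length u = length v"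
  by (induction rule: word_cong.induct) auto

lemma mult_generator_neq_one: "g * T1 \<noteq> 1" "g * T2 \<noteq> 1"
  by (transfer, auto dest: word_cong_length)+

lemma act_act: "act h (act g x) = act (g * h) x"
  by (simp add: act_def mult.assoc)

lemma act_one: "act 1 x = x"
  by (simp add: act_def)

text \<open>A nonempty path from \<open>x\<close> ends at \<open>act g x\<close> with
  \<open>g\<close> a nonempty product of generators, hence \<open>g \<noteq> 1\<close>. A cycle
  would make \<open>g\<close> and \<open>1\<close> act alike on \<open>x\<close>.\<close>

lemma acyclic_Xstar: "acyclic {(x, y). x \<in> Xstar \<and> (y = act T1 x \<or> y = act T2 x)}"
proof -
  let ?E = "{(x, y). x \<in> Xstar \<and> (y = act T1 x \<or> y = act T2 x)}"
  have reach: "x \<in> Xstar \<and> (\<exists>g. g \<noteq> 1 \<and> y = act g x)" if "(x, y) \<in> ?E\<^sup>+" for x y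
    using that
  proof (induction rule: trancl_induct)
    case (base y)
    then show ?case
      using mult_generator_neq_one[of 1] by auto
  next
    case (step y z)
    then obtain g where "x \<in> Xstar" "y = act g x"
      by blast
    with step.hyps(2) have "z = act (g * T1) x \<or> z = act (g * T2) x"
      by (simp add: act_act)
    then show ?case
      using \<open>x \<in> Xstar\<close> mult_generator_neq_one[of g] by metis
  qed
  show ?thesis
    unfolding acyclic_def
  proof (intro allI notI)
    fix x assume "(x, x) \<in> ?E\<^sup>+"
    then obtain g where "x \<in> Xstar" "g \<noteq> 1" "x = act g x"
      using reach[of x x] by blast
    then have "act g x \<noteq> act 1 x"
      unfolding Xstar_def by blast
    with \<open>x = act g x\<close> show False
      by (simp add: act_one)
  qed
qed

lemma r_le_one: "r s x i j \<le> 1"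
proof -
  let ?a = "\<lambda>n. (1 / 2) ^ Suc n * of_bool (x (s i j (Suc n))) :: real"
  have le: "?a n \<le> (1 / 2) ^ Suc n" for n
    by (simp add: of_bool_def)
  have "summable ?a"
    by (rule summable_comparison_test'[OF sums_summable[OF power_half_series]])
      (simp add: of_bool_def)
  then have "suminf ?a \<le> (\<Sum>n. (1 / 2) ^ Suc n)"
    by (intro suminf_le le sums_summable[OF power_half_series])
  also have "\<dots> = 1"
    using power_half_series by (rule sums_unique[symmetric])
  finally show ?thesis
    by (simp add: r_def)
qed

lemma delta_in_argmax_hullI: "(\<And>k. f k \<le> f i) \<Longrightarrow> \<delta> i \<in> argmax_hull f"
  unfolding argmax_hull_def
  by (intro hull_inc imageI) (auto simp: is_arg_max_def not_less)

text \<open>Column \<open>j\<close> of the matrix has \<open>1\<close> in row \<open>j\<close> and,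
  by \<open>r_le_one\<close>, nothing larger elsewhere.\<close>

lemma delta_in_argmax_hull_A: "\<delta> j \<in> argmax_hull (\<lambda>i. (A s x *v \<delta> j) $ i)"
  by (intro delta_in_argmax_hullI)
    (simp add: \<delta>_def matrix_vector_mult_basis column_def A_def r_le_one)

text \<open>The unique row \<open>i\<close> in which the array \<open>B1\<close> (for true
  \<open>e\<close>) or \<open>B0\<close> has entry 1 at \<open>j\<close>, \<open>k\<close>.\<close>

definition next_colour :: "bool \<Rightarrow> 3 \<Rightarrow> 3 \<Rightarrow> 3" where
  "next_colour e j k =
     (if e then j + 1
      else if k \<noteq> 1 then (if j \<noteq> 3 then j else 1)
      else (if j \<noteq> 3 then j + 1 else 3))"

text \<open>At vertices the double sum collapses to one array entry, which is 0 or 1, and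
  \<open>next_colour\<close> picks an entry 1.\<close>

lemma delta_in_argmax_hull_B:
  "\<delta> (next_colour e j k) \<in> argmax_hull (\<lambda>i. \<Sum>j'\<in>UNIV. \<Sum>k'\<in>UNIV.
     \<delta> j $ j' * \<delta> k $ k' * (if e then B1 else B0) i j' k')"
proof -
  have "(\<Sum>j'\<in>UNIV. \<Sum>k'\<in>UNIV. \<delta> j $ j' * \<delta> k $ k' * b j' k') = b j k"
    for b :: "3 \<Rightarrow> 3 \<Rightarrow> real"
  proof -
    have "(\<Sum>j'\<in>UNIV. \<Sum>k'\<in>UNIV. \<delta> j $ j' * \<delta> k $ k' * b j' k')
        = (\<Sum>j'\<in>UNIV. \<Sum>k'\<in>UNIV. if k' = k then (if j' = j then b j' k' else 0) else 0)"
      by (intro sum.cong refl) (auto simp: \<delta>_def axis_def)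
    then show ?thesis
      by simp
  qed
  then show ?thesis
    by (intro delta_in_argmax_hullI) (auto simp: B1_def B0_def next_colour_def)
qed

lemma delta_in_C: "\<delta> i \<in> C"
  by (simp add: C_def \<delta>_def axis_def)

theorem theorem2:
  fixes s :: "3 \<Rightarrow> 3 \<Rightarrow> nat \<Rightarrow> G"
  assumes "enumerated_partition s"
  shows "\<exists>c \<in> colourings Xstar. pure_colouring Xstar c \<and> satisfies_F s Xstar c"
proof -
  from acyclic_recursion_solvable[OF acyclic_Xstar, of "\<lambda>x. next_colour (x 1)"]
  obtain f where f: "\<forall>x\<in>Xstar. f x = next_colour (x 1) (f (act T1 x)) (f (act T2 x))" ..
  define h where "h x l = (case l of Label_a \<Rightarrow> f x | Label_b \<Rightarrow> f (act T1 x)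
    | Label_c \<Rightarrow> f (act T2 x))" for x l
  \<comment> \<open>The restriction is there because \<open>colourings\<close> consists of
    extensional functions.\<close>
  define c where "c = restrict (\<lambda>(x, l). \<delta> (h x l)) (Xstar \<times> UNIV)"
  have c: "c (x, Label_a) = \<delta> (f x)" "c (x, Label_b) = \<delta> (f (act T1 x))"
    "c (x, Label_c) = \<delta> (f (act T2 x))" if "x \<in> Xstar" for x
    using that by (simp_all add: c_def h_def)
  have "c \<in> colourings Xstar"
    by (auto simp: colourings_def c_def delta_in_C)
  moreover have "pure_colouring Xstar c"
  proof -
    have "\<delta> i \<in> {\<delta> 1, \<delta> 2, \<delta> 3}" for i
      using exhaust_3[of i] by auto
    then show ?thesis
      by (fastforce simp: pure_colouring_def c_def)
  qed
  moreover have "satisfies_F s Xstar c"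
    unfolding satisfies_F_def
  proof (intro ballI conjI)
    fix x assume x: "x \<in> Xstar"
    \<comment> \<open>The rule also reads \<open>c\<close> at the images of \<open>x\<close>, where
      its formula holds because \<open>Xstar\<close> is invariant.\<close>
    note c_simps = c[OF x] c(1)[OF Xstar_invariant(1)[OF x]] c(1)[OF Xstar_invariant(2)[OF x]]
    show "c (x, Label_b) \<in> argmax_hull (\<lambda>i. (A s (act (T2 * T1 * T2) x) *v c (act T1 x, Label_a)) $ i)"
      unfolding c_simps by (rule delta_in_argmax_hull_A)
    show "c (x, Label_c) \<in> argmax_hull (\<lambda>i. (A s (act (T1 * T2 * T1) x) *v c (act T2 x, Label_a)) $ i)"
      unfolding c_simps by (rule delta_in_argmax_hull_A)
    show "c (x, Label_a) \<in> argmax_hull (\<lambda>i. \<Sum>j\<in>UNIV. \<Sum>k\<in>UNIV.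
        c (x, Label_b) $ j * c (x, Label_c) $ k * (if x 1 then B1 else B0) i j k)"
      unfolding c_simps bspec[OF f x] by (rule delta_in_argmax_hull_B)
  qed
  ultimately show ?thesis
    by blast
qed

end
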